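(* Let $\{\theta_n\}$ be a sequence of $\mathbb{R}^d$-valued random variables. If there is a (measurable) function $\phi:\mathbb{R}^d\to[0,\infty)$ such that $\phi(\theta)\to\infty$ as $\|\theta\|\to\infty$ and $$\liminf_{n\to\infty}E[\phi(\theta_n)]<\infty,$$ then $\{\theta_n\}$ is asymptotically tight.
   Context: A sequence of random variables $\{\theta_n\}$ is called asymptotically tight if for each $\epsilon>0$ there exists a compact set $K_\epsilon$ such that $\limsup_{n\to\infty}P(\theta_n\in K_\epsilon)\ge1-\epsilon$. *)

theory Defs
  imports "HOL-Probability.Probability"
begin

text \<open>The limit superior is taken in the extended reals, since the library's \<^const>\<open>limsup\<close>
  needs a complete lattice. Compact sets are closed, hence Borel, in a Hausdorff space.\<close>

definition asymptotically_tight ::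
    "'w measure \<Rightarrow> (nat \<Rightarrow> 'w \<Rightarrow> 'a::t2_space) \<Rightarrow> bool" where
  "asymptotically_tight M \<theta> \<longleftrightarrow>
     (\<forall>\<epsilon>::real. \<epsilon> > 0 \<longrightarrow>
       (\<exists>K. compact K \<and>
          limsup (\<lambda>n. ereal (measure M {\<omega> \<in> space M. \<theta> n \<omega> \<in> K})) \<ge> ereal (1 - \<epsilon>)))"

end

theory Submission
  imports Defs
begin

text \<open>If \<open>\<phi> \<ge> C / \<epsilon>\<close> outside a ball \<open>K\<close>, then by Markov's inequality every \<open>n\<close> with
  \<open>P(\<theta>\<^sub>n \<in> K) < 1 - \<epsilon>\<close> has \<open>E[\<phi>(\<theta>\<^sub>n)] \<ge> C\<close>. A limes superior of \<open>P(\<theta>\<^sub>n \<in> K)\<close> below \<open>1 - \<epsilon>\<close>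
  therefore forces the limes inferior of the expectations to be at least \<open>C\<close>; take \<open>C\<close> above it.\<close>

text \<open>The integrand dominates \<open>t\<close> times the indicator of the complement of
  \<open>A\<close>, a set of probability at least \<epsilon>.\<close>

lemma (in prob_space) nn_integral_ge_if_prob_small:
  fixes f :: "'a \<Rightarrow> real" and t \<epsilon> :: real
  assumes A: "A \<in> events" and t: "t \<ge> 0" and \<epsilon>: "\<epsilon> \<ge> 0"
    and f: "\<And>\<omega>. \<omega> \<in> space M - A \<Longrightarrow> t \<le> f \<omega>"
    and small: "prob A \<le> 1 - \<epsilon>"
  shows "ennreal (t * \<epsilon>) \<le> (\<integral>\<^sup>+ \<omega>. ennreal (f \<omega>) \<partial>M)"
proof -
  have "ennreal (t * \<epsilon>) \<le> ennreal t * emeasure M (space M - A)"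
    using small prob_compl[OF A] t \<epsilon>
    by (simp add: emeasure_eq_measure flip: ennreal_mult) (intro ennreal_leI mult_left_mono; simp)
  also have "\<dots> = (\<integral>\<^sup>+ \<omega>. ennreal t * indicator (space M - A) \<omega> \<partial>M)"
    using A by (simp add: nn_integral_cmult_indicator)
  also have "\<dots> \<le> (\<integral>\<^sup>+ \<omega>. ennreal (f \<omega>) \<partial>M)"
    by (intro nn_integral_mono) (auto intro: ennreal_leI f split: split_indicator)
  finally show ?thesis .
qed

theorem mainTheorem7:
  fixes M :: "'w measure"
    and \<theta> :: "nat \<Rightarrow> 'w \<Rightarrow> real ^ 'd"
    and \<phi> :: "real ^ 'd \<Rightarrow> real"
  assumes "prob_space M"
    and "\<And>n. \<theta> n \<in> measurable M borel"
    and "\<phi> \<in> borel_measurable borel"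
    and "\<And>x. \<phi> x \<ge> 0"
    and "filterlim \<phi> at_top at_infinity"
    and "liminf (\<lambda>n. \<integral>\<^sup>+ \<omega>. ennreal (\<phi> (\<theta> n \<omega>)) \<partial>M) < \<infinity>"
  shows "asymptotically_tight M \<theta>"
  unfolding asymptotically_tight_def
proof (intro allI impI)
  fix \<epsilon> :: real assume \<epsilon>: "\<epsilon> > 0"
  interpret prob_space M by fact
  let ?E = "\<lambda>n. \<integral>\<^sup>+ \<omega>. ennreal (\<phi> (\<theta> n \<omega>)) \<partial>M"
  \<comment> \<open>Density of the order on \<open>ennreal\<close> gives a finite \<open>C\<close>
    strictly above the liminf; strictness yields the final contradiction.\<close>
  obtain C :: real where C: "C \<ge> 0" "liminf ?E < ennreal C"
  proof -
    obtain c where "liminf ?E < c" "c < \<infinity>" using assms(6) dense by blast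
    then show thesis using that by (cases c) auto
  qed
  \<comment> \<open>With this threshold the Markov bound is exactly
    \<open>C / \<epsilon> * \<epsilon> = C\<close>.\<close>
  have "eventually (\<lambda>x. C / \<epsilon> \<le> \<phi> x) at_infinity"
    using assms(5) by (simp add: filterlim_at_top)
  then obtain R where R: "\<And>x. R \<le> norm x \<Longrightarrow> C / \<epsilon> \<le> \<phi> x"
    by (auto simp: eventually_at_infinity)
  let ?A = "\<lambda>n. {\<omega> \<in> space M. \<theta> n \<omega> \<in> cball 0 R}"
  have A: "?A n \<in> events" for n
    using measurable_sets[OF assms(2), of "cball 0 R" n]
    by (simp add: vimage_def Int_def conj_commute)
  have "ereal (1 - \<epsilon>) \<le> limsup (\<lambda>n. ereal (prob (?A n)))"
  proof (rule ccontr)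
    assume "\<not> ?thesis"
    \<comment> \<open>A limsup strictly below the bound controls all large \<open>n\<close>, not
      just infinitely many, so the liminf of the expectations is bounded below.\<close>
    then have "eventually (\<lambda>n. ereal (prob (?A n)) < ereal (1 - \<epsilon>)) sequentially"
      by (intro Limsup_lessD) simp
    then have "eventually (\<lambda>n. ennreal C \<le> ?E n) sequentially"
    proof eventually_elim
      case (elim n)
      have "ennreal (C / \<epsilon> * \<epsilon>) \<le> ?E n"
        using elim \<epsilon> C(1) by (intro nn_integral_ge_if_prob_small[OF A[of n]]) (auto intro: R)
      then show ?case using \<epsilon> by simp
    qed
    then have "ennreal C \<le> liminf ?E" by (rule Liminf_bounded)
    with C(2) show False by simp
  qed
  then show "\<exists>K. compact K \<and>
      limsup (\<lambda>n. ereal (prob {\<omega> \<in> space M. \<theta> n \<omega> \<in> K})) \<ge> ereal (1 - \<epsilon>)"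
    using compact_cball by blast
qed

end
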